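(* For $|q|<1$, $$\sum_{n=1}^{\infty} \overline{\mathrm{spt}}_{\omega}(n)q^n =\frac{(-q^2;q^2)_{\infty}}{(q^2;q^2)_{\infty}} \sum_{n=1}^{\infty} \frac{nq^{n}}{1-q^n} +2 \frac{(-q^2;q^2)_{\infty} }{(q^2;q^2)_{\infty}} \sum_{n=1}^{\infty} \frac{(-1)^n q^{2n(n+1)}}{(1-q^{2n})^2}.$$
   Context: $(a;q)_n=\prod_{j=0}^{n-1}(1-aq^j)$, $(a;q)_\infty=\prod_{j\ge0}(1-aq^j)$. $\overline{\mathrm{spt}}_{\omega}(n)$ is defined by $\sum_{n\ge1}\overline{\mathrm{spt}}_{\omega}(n)q^n=\sum_{n\ge1}\frac{q^{n}(-q^{n+1};q)_{n}(-q^{2n+2};q^2)_{\infty}}{(1-q^n)^2(q^{n+1};q)_n(q^{2n+2};q^2)_{\infty}}$ (the number of smallest parts in overpartitions of $n$ with smallest part overlined and all odd parts less than twice the smallest part). *)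

theory Defs
  imports "HOL-Analysis.Analysis"
begin

definition qpoch :: "complex \<Rightarrow> complex \<Rightarrow> nat \<Rightarrow> complex" where
  "qpoch a q n = (\<Prod>j<n. 1 - a * q ^ j)"

definition qpoch_inf :: "complex \<Rightarrow> complex \<Rightarrow> complex" where
  "qpoch_inf a q = (\<Prod>j. 1 - a * q ^ j)"

definition spt_term :: "complex \<Rightarrow> nat \<Rightarrow> complex" where
  "spt_term q n =
     q ^ n * qpoch (- (q ^ (n + 1))) q n * qpoch_inf (- (q ^ (2 * n + 2))) (q ^ 2)
     / ((1 - q ^ n) ^ 2 * qpoch (q ^ (n + 1)) q n * qpoch_inf (q ^ (2 * n + 2)) (q ^ 2))"

definition spt_gen :: "complex \<Rightarrow> complex" where
  "spt_gen q = (\<Sum>n. spt_term q (Suc n))"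

definition spt_bar_omega :: "nat \<Rightarrow> complex" where
  "spt_bar_omega n = (deriv ^^ n) spt_gen 0 / fact n"

end

theory Submission
  imports Defs "HOL-Complex_Analysis.Complex_Analysis"
begin

text \<open>
  After dividing by \<open>(-q\<^sup>2;q\<^sup>2)\<^sub>\<infinity> / (q\<^sup>2;q\<^sup>2)\<^sub>\<infinity>\<close>, the \<open>n\<close>-th summand of the generating function becomes
  \<open>q\<^sup>n (q;q)\<^sub>n\<^sub>-\<^sub>1\<^sup>2 \<beta>\<^sub>n\<close> with \<open>\<beta>\<^sub>n = (-q;q\<^sup>2)\<^sub>n / (q;q)\<^sub>2\<^sub>n\<close>. A Bailey pair expresses \<open>\<beta>\<^sub>n\<close> as the sum over
  \<open>r\<close> of \<open>(-1)\<^sup>r q\<^bsup>2r\<^sup>2\<^esup> / ((q;q)\<^bsub>n-2r\<^esub> (q;q)\<^bsub>n+2r\<^esub>)\<close>. For \<open>k = 2r \<noteq> 0\<close> the sum over \<open>n\<close> telescopes, because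
  \<open>q\<^sup>n (1 - q\<^sup>k)\<^sup>2 = q\<^sup>k ((1 - q\<^sup>n)\<^sup>2 - (1 - q\<^bsup>n-k\<^esup>) (1 - q\<^bsup>n+k\<^esup>))\<close>, and for \<open>r = 0\<close> it is a Lambert series.
  Tannery's theorem justifies letting the number of summands tend to infinity. The resulting closed form is
  holomorphic in the unit disc, so its Taylor series at \<open>0\<close> converges to it.
\<close>

subsection \<open>A Bailey pair\<close>

lemma one_minus_power_nonzero:
  fixes q :: complex
  assumes "norm q < 1" "n > 0"
  shows "1 - q ^ n \<noteq> 0"
proof -
  have "norm (q ^ n) < 1"
    using assms by (simp add: norm_power power_less_one_iff)
  then show ?thesis by auto
qed

lemma qpoch_0 [simp]: "qpoch a q 0 = 1"
  by (simp add: qpoch_def)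

lemma qpoch_Suc: "qpoch a q (Suc n) = qpoch a q n * (1 - a * q ^ n)"
  by (simp add: qpoch_def)

lemma qpoch_factor_nonzero:
  fixes q :: complex
  assumes "norm q < 1" "norm a < 1"
  shows "1 - a * q ^ j \<noteq> 0"
proof -
  have "norm (a * q ^ j) = norm a * norm q ^ j" by (simp add: norm_mult norm_power)
  also have "\<dots> \<le> norm a * 1"
    using assms by (intro mult_left_mono power_le_one) auto
  also have "\<dots> < 1" using assms by simp
  finally show ?thesis by auto
qed

lemma qpoch_nonzero: "norm q < 1 \<Longrightarrow> norm a < 1 \<Longrightarrow> qpoch a q n \<noteq> 0"
  using qpoch_factor_nonzero by (simp add: qpoch_def)

text \<open>The convention \<open>1 / (q;q)\<^sub>j = 0\<close> for \<open>j < 0\<close> makes the recurrence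
  \<open>qrecip_pred\<close> and the q-Pascal identities below hold without boundary cases.\<close>

definition qrecip :: "complex \<Rightarrow> int \<Rightarrow> complex" where
  "qrecip q j = (if j < 0 then 0 else 1 / qpoch q q (nat j))"

lemma qrecip_pred:
  assumes "norm q < 1"
  shows "qrecip q (j - 1) = (1 - q powi j) * qrecip q j"
proof (cases "j \<le> 0")
  case True
  then show ?thesis by (auto simp: qrecip_def)
next
  case False
  then obtain m where j: "j = int (Suc m)"
    by (metis gr0_implies_Suc not_le zero_less_imp_eq_int)
  have m: "nat (int (Suc m)) = Suc m" "nat (int (Suc m) - 1) = m" by auto
  have "q powi j = q ^ Suc m"
    unfolding j by (rule power_int_of_nat)
  moreover have "1 - q * q ^ m \<noteq> 0"
    using one_minus_power_nonzero[OF assms, of "Suc m"] by simp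
  ultimately show ?thesis
    using False unfolding qrecip_def j m by (simp add: qpoch_Suc)
qed

text \<open>The q-binomial coefficient \<open>[2n, n + k]\<close>, centred at \<open>k = 0\<close>.\<close>

definition qbinom_mid :: "complex \<Rightarrow> nat \<Rightarrow> int \<Rightarrow> complex" where
  "qbinom_mid q n k = qpoch q q (2 * n) * qrecip q (int n - k) * qrecip q (int n + k)"

lemma qbinom_mid_minus: "qbinom_mid q n (- k) = qbinom_mid q n k"
  by (simp add: qbinom_mid_def)

lemma qbinom_mid_eq_0: "\<bar>k\<bar> > int n \<Longrightarrow> qbinom_mid q n k = 0"
  by (auto simp: qbinom_mid_def qrecip_def)

text \<open>This amounts to two applications of the q-Pascal rule. All terms share the factor
  \<open>qpoch q q (2 * n) * A * B\<close>, with \<open>A\<close>, \<open>B\<close> the reciprocals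
  at \<open>int n + 1 - k\<close> and \<open>int n + 1 + k\<close>, so an elementary identity
  remains.\<close>

lemma qbinom_mid_Suc:
  assumes q: "norm q < 1" "q \<noteq> 0"
  shows "qbinom_mid q (Suc n) k = (1 + q ^ (2 * n + 1)) * qbinom_mid q n k
      + q powi (int n + 1 - k) * qbinom_mid q n (k - 1)
      + q powi (int n + 1 + k) * qbinom_mid q n (k + 1)"
proof -
  define X where "X = q powi (int n + 1 - k)"
  define Y where "Y = q powi (int n + 1 + k)"
  define Z where "Z = q ^ (2 * n + 1)"
  have XY: "X * Y = Z * q"
  proof -
    have "X * Y = q powi int (2 * n + 2)"
      unfolding X_def Y_def using q(2) by (simp flip: power_int_add add: algebra_simps)
    also have "\<dots> = Z * q"
      unfolding power_int_of_nat Z_def by simp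
    finally show ?thesis .
  qed
  define A where "A = qrecip q (int n + 1 - k)"
  define B where "B = qrecip q (int n + 1 + k)"
  have A1: "qrecip q (int n - k) = (1 - X) * A"
    using qrecip_pred[OF q(1), of "int n + 1 - k"] by (simp add: A_def X_def)
  have B1: "qrecip q (int n + k) = (1 - Y) * B"
    using qrecip_pred[OF q(1), of "int n + 1 + k"] by (simp add: B_def Y_def)
  have A2: "qrecip q (int n - (k + 1)) = (1 - X / q) * (1 - X) * A"
  proof -
    have "q powi (int n - k) = X / q"
      unfolding X_def using q(2) by (subst power_int_diff[symmetric, of _ _ 1, simplified]) (auto simp: algebra_simps)
    then show ?thesis
      using qrecip_pred[OF q(1), of "int n - k"] A1 by (simp add: diff_diff_eq)
  qed
  have B2: "qrecip q (int n + (k - 1)) = (1 - Y / q) * (1 - Y) * B"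
  proof -
    have "q powi (int n + k) = Y / q"
      unfolding Y_def using q(2) by (subst power_int_diff[symmetric, of _ _ 1, simplified]) (auto simp: algebra_simps)
    then show ?thesis
      using qrecip_pred[OF q(1), of "int n + k"] B1 by (simp add: add_diff_eq)
  qed
  have "qpoch q q (2 * Suc n) = qpoch q q (2 * n) * (1 - Z) * (1 - Z * q)"
    by (simp add: qpoch_Suc Z_def mult_ac)
  then have L: "qbinom_mid q (Suc n) k = qpoch q q (2 * n) * (1 - Z) * (1 - Z * q) * A * B"
    by (simp add: qbinom_mid_def A_def B_def add_ac)
  \<comment> \<open>\<open>U\<close> and \<open>V\<close> remove the divisions by \<open>q\<close>:
    since \<open>X = U * q\<close>, \<open>Y = V * q\<close> and \<open>Z = U * V * q\<close>, the
    claim becomes a polynomial identity in \<open>U\<close>, \<open>V\<close>,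
    \<open>q\<close>.\<close>
  define U where "U = X / q"
  define V where "V = Y / q"
  have UV: "X = U * q" "Y = V * q" using q(2) by (auto simp: U_def V_def)
  have Zq: "Z = U * V * q"
    using XY UV q(2) by auto
  have "(1 - Z) * (1 - Z * q) = (1 + Z) * (1 - X) * (1 - Y)
      + X * (1 - V) * (1 - Y) + Y * (1 - U) * (1 - X)"
    unfolding Zq UV by (simp add: algebra_simps)
  then have "qbinom_mid q (Suc n) k = qpoch q q (2 * n) * A * B *
     ((1 + Z) * (1 - X) * (1 - Y) + X * (1 - V) * (1 - Y) + Y * (1 - U) * (1 - X))"
    unfolding L by simp
  also have "\<dots> = (1 + Z) * qbinom_mid q n k + X * qbinom_mid q n (k - 1) + Y * qbinom_mid q n (k + 1)"
  proof -
    have "qrecip q (int n - (k - 1)) = A" "qrecip q (int n + (k + 1)) = B"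
      by (simp_all add: A_def B_def algebra_simps)
    then show ?thesis
      unfolding qbinom_mid_def A1 B1 A2 B2 U_def V_def by (simp add: algebra_simps)
  qed
  finally show ?thesis unfolding X_def Y_def Z_def .
qed

text \<open>The additional indices have \<open>\<bar>2 * r\<bar> > n\<close>, where the coefficient
  is 0. Sums for different \<open>n\<close> can thus share one range of \<open>r\<close>.\<close>

lemma sum_qbinom_mid_extend:
  assumes "n \<le> m"
  shows "(\<Sum>r\<in>{-int m..int m}. f r * qbinom_mid q n (2 * r))
       = (\<Sum>r\<in>{-int n..int n}. f r * qbinom_mid q n (2 * r))"
  by (rule sum.mono_neutral_right) (use assms in \<open>auto intro!: qbinom_mid_eq_0\<close>)

text \<open>The weight \<open>x^k q^(k^2/2)\<close> of the triple product at
  \<open>k = 2 * r\<close> and \<open>x = \<i>\<close>.\<close>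

definition alt_wt :: "complex \<Rightarrow> int \<Rightarrow> complex" where
  "alt_wt q r = (-1) powi r * q powi (2 * r\<^sup>2)"

text \<open>The reflection \<open>r \<mapsto> 1 - r\<close> reverses the sign of every summand.\<close>

lemma sum_odd_part:
  assumes "q \<noteq> 0"
  shows "(\<Sum>r\<in>{-int (Suc n)..int (Suc n)}.
            alt_wt q r * q powi (int n + 1 - 2 * r) * qbinom_mid q n (2 * r - 1)) = 0"
    (is "sum ?f _ = 0")
proof -
  \<comment> \<open>Dropping the left end point, whose summand is 0, leaves an interval invariant
    under the reflection.\<close>
  have "sum ?f {-int (Suc n)..int (Suc n)} = sum ?f {-int n..int (Suc n)}"
    by (rule sum.mono_neutral_right) (auto intro!: qbinom_mid_eq_0)
  moreover have "sum ?f {-int n..int (Suc n)} = - sum ?f {-int n..int (Suc n)}"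
  proof -
    have refl: "?f (1 - r) = - ?f r" for r
    proof -
      have "qbinom_mid q n (2 * (1 - r) - 1) = qbinom_mid q n (2 * r - 1)"
        using qbinom_mid_minus[of q n "2 * r - 1"] by (simp add: algebra_simps)
      \<comment> \<open>Both products have exponent \<open>2 r^2 - 2 r + n + 1\<close>, so only the
        sign factor changes.\<close>
      moreover have "q powi (2 * (1 - r)\<^sup>2) * q powi (int n + 1 - 2 * (1 - r))
          = q powi (2 * r\<^sup>2) * q powi (int n + 1 - 2 * r)"
        using assms by (simp flip: power_int_add add: power2_eq_square algebra_simps)
      moreover have "(-1 :: complex) powi (1 - r) = - ((-1) powi r)"
        by (subst power_int_diff) (simp_all add: divide_inverse power_int_minus_one_minus flip: power_int_minus)
      ultimately show ?thesis by (simp add: alt_wt_def mult.assoc)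
    qed
    have "sum ?f {-int n..int (Suc n)} = (\<Sum>r\<in>{-int n..int (Suc n)}. ?f (1 - r))"
      by (rule sum.reindex_bij_witness[of _ "\<lambda>r. 1 - r" "\<lambda>r. 1 - r"]) auto
    then show ?thesis by (simp only: refl sum_negf)
  qed
  ultimately show ?thesis by simp
qed

text \<open>The finite Jacobi triple product in \<open>x\<close> at \<open>x = \<i>\<close>, where the odd powers of \<open>x\<close>
  cancel; this is Slater's Bailey pair with \<open>\<beta>\<^sub>n = (-q;q\<^sup>2)\<^sub>n / (q;q)\<^sub>2\<^sub>n\<close>.\<close>

lemma sum_alt_wt_qbinom_mid:
  assumes q: "norm q < 1" "q \<noteq> 0"
  shows "(\<Sum>r\<in>{-int n..int n}. alt_wt q r * qbinom_mid q n (2 * r)) = qpoch (- q) (q\<^sup>2) n"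
proof (induction n)
  case 0
  then show ?case by (simp add: alt_wt_def qbinom_mid_def qrecip_def)
next
  case (Suc n)
  let ?I = "{-int (Suc n)..int (Suc n)}"
  let ?f = "\<lambda>r. alt_wt q r * q powi (int n + 1 - 2 * r) * qbinom_mid q n (2 * r - 1)"
  \<comment> \<open>By symmetry in \<open>k\<close>, the last term of the recurrence is
    \<open>?f (- r)\<close>. Both neighbour terms therefore contribute the same sum over
    \<open>r\<close>, which vanishes.\<close>
  have "alt_wt q r * qbinom_mid q (Suc n) (2 * r)
      = (1 + q ^ (2 * n + 1)) * (alt_wt q r * qbinom_mid q n (2 * r)) + ?f r + ?f (- r)" for r
  proof -
    have "qbinom_mid q n (2 * - r - 1) = qbinom_mid q n (2 * r + 1)"
    proof -
      have "2 * - r - 1 = - (2 * r + 1)" by simp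
      then show ?thesis using qbinom_mid_minus[of q n "2 * r + 1"] by (simp only:)
    qed
    moreover have "alt_wt q (- r) = alt_wt q r"
      by (simp add: alt_wt_def power_int_minus_one_minus)
    ultimately show ?thesis
      unfolding qbinom_mid_Suc[OF q] by (simp add: ring_distribs mult_ac)
  qed
  then have "(\<Sum>r\<in>?I. alt_wt q r * qbinom_mid q (Suc n) (2 * r))
      = (1 + q ^ (2 * n + 1)) * (\<Sum>r\<in>?I. alt_wt q r * qbinom_mid q n (2 * r))
        + sum ?f ?I + (\<Sum>r\<in>?I. ?f (- r))"
    by (simp only: sum.distrib sum_distrib_left)
  also have "(\<Sum>r\<in>?I. ?f (- r)) = sum ?f ?I"
    by (rule sum.reindex_bij_witness[of _ uminus uminus]) auto
  also have "sum ?f ?I = 0"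
    by (rule sum_odd_part[OF q(2)])
  also have "(\<Sum>r\<in>?I. alt_wt q r * qbinom_mid q n (2 * r)) = qpoch (- q) (q\<^sup>2) n"
    using sum_qbinom_mid_extend[of n "Suc n" "alt_wt q" q] Suc.IH by simp
  finally show ?case
    by (simp add: qpoch_Suc mult.commute flip: power_mult)
qed

lemma sum_symmetric_int:
  fixes f :: "int \<Rightarrow> 'a :: comm_semiring_1"
  assumes "\<And>r. f (- r) = f r"
  shows "(\<Sum>r\<in>{-int n..int n}. f r) = f 0 + 2 * (\<Sum>r=1..n. f (int r))"
proof (induction n)
  case (Suc n)
  have "{-int (Suc n)..int (Suc n)} = insert (- int (Suc n)) (insert (int (Suc n)) {-int n..int n})"
    by auto
  then show ?case using Suc assms[of "int (Suc n)"] by (simp add: algebra_simps mult_2)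
qed auto

subsection \<open>Telescoping partial sums\<close>

text \<open>For \<open>norm q < 1\<close> this is the ratio of \<open>qbinom_mid q n k\<close> to
  the central coefficient \<open>qbinom_mid q n 0\<close>.\<close>

definition bailey_kernel :: "complex \<Rightarrow> nat \<Rightarrow> nat \<Rightarrow> complex" where
  "bailey_kernel q n k = (qpoch q q n)\<^sup>2 * qrecip q (int n - int k) * qrecip q (int n + int k)"

lemma bailey_kernel_eq_0: "n < k \<Longrightarrow> bailey_kernel q n k = 0"
  by (simp add: bailey_kernel_def qrecip_def)

text \<open>A common factor pulls out of the kernel difference and leaves
  \<open>W = (1 - Z)^2 - (1 - X) * (1 - Y)\<close>. With \<open>X = Z / K\<close> and
  \<open>Y = Z * K\<close> one has \<open>K * W = Z * (1 - K)^2\<close>.\<close>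

lemma bailey_kernel_telescope:
  assumes q: "norm q < 1" "q \<noteq> 0" and k: "k > 0"
  shows "q ^ Suc n * (qpoch q q n)\<^sup>2 * (qrecip q (int (Suc n) - int k) * qrecip q (int (Suc n) + int k))
       = q ^ k / (1 - q ^ k)\<^sup>2 * (bailey_kernel q (Suc n) k - bailey_kernel q n k)"
proof -
  define X where "X = q powi (int (Suc n) - int k)"
  define Y where "Y = q powi (int (Suc n) + int k)"
  define Z where "Z = q ^ Suc n"
  define K where "K = q ^ k"
  define A where "A = qrecip q (int (Suc n) - int k)"
  define B where "B = qrecip q (int (Suc n) + int k)"
  have K: "K \<noteq> 0" "1 - K \<noteq> 0"
    using q one_minus_power_nonzero[OF q(1) k] by (auto simp: K_def)
  have X: "X = Z / K" unfolding X_def Z_def K_def power_int_diff[OF disjI1, OF q(2)] power_int_of_nat ..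
  have Y: "Y = Z * K" unfolding Y_def Z_def K_def power_int_add[OF disjI1, OF q(2)] power_int_of_nat ..
  have A1: "qrecip q (int n - int k) = (1 - X) * A"
    using qrecip_pred[OF q(1), of "int (Suc n) - int k"] by (simp add: A_def X_def)
  have B1: "qrecip q (int n + int k) = (1 - Y) * B"
    using qrecip_pred[OF q(1), of "int (Suc n) + int k"] by (simp add: B_def Y_def)
  have Q: "qpoch q q (Suc n) = qpoch q q n * (1 - Z)"
    by (simp add: qpoch_Suc Z_def)
  define W where "W = (1 - Z)\<^sup>2 - (1 - X) * (1 - Y)"
  define D where "D = K / (1 - K)\<^sup>2"
  have "K * W = Z * (1 - K)\<^sup>2"
    unfolding W_def X Y using K(1) by (simp add: field_simps power2_eq_square)
  then have "Z = D * W"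
    unfolding D_def using K(2) by (simp add: field_simps)
  then have "Z * ((qpoch q q n)\<^sup>2 * A * B)
      = D * W * ((qpoch q q n)\<^sup>2 * A * B)"
    by (rule arg_cong)
  then show ?thesis
    unfolding bailey_kernel_def A1 B1 Q
    unfolding A_def[symmetric] B_def[symmetric] Z_def[symmetric] K_def[symmetric] D_def[symmetric]
    by (simp add: W_def algebra_simps power2_eq_square)
qed

text \<open>Indices are shifted by one: \<open>reduced_term q n\<close> and \<open>theta_coeff q r\<close> are the summands with
  indices \<open>n + 1\<close> and \<open>r + 1\<close> of the series starting at \<open>1\<close>.\<close>

definition reduced_term :: "complex \<Rightarrow> nat \<Rightarrow> complex" where
  "reduced_term q n = q ^ Suc n * (qpoch q q n)\<^sup>2 * qpoch (- q) (q\<^sup>2) (Suc n) / qpoch q q (2 * Suc n)"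

definition theta_coeff :: "complex \<Rightarrow> nat \<Rightarrow> complex" where
  "theta_coeff q r = (-1) ^ Suc r * q ^ (2 * Suc r * (Suc r + 1)) / (1 - q ^ (2 * Suc r))\<^sup>2"

text \<open>The Bailey pair is inserted and \<open>r\<close>, \<open>-r\<close> are paired;
  \<open>r = 0\<close> gives the Lambert term. The bound \<open>N\<close> does not depend on
  \<open>n\<close>, so that the sums over \<open>n\<close> and \<open>r\<close> can later be
  interchanged.\<close>

lemma reduced_term_eq:
  assumes q: "norm q < 1" "q \<noteq> 0" and "n < N"
  shows "reduced_term q n = q ^ Suc n / (1 - q ^ Suc n)\<^sup>2
    + 2 * (\<Sum>r<N. theta_coeff q r *
        (bailey_kernel q (Suc n) (2 * Suc r) - bailey_kernel q n (2 * Suc r)))"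
proof -
  let ?c = "q ^ Suc n * (qpoch q q n)\<^sup>2"
  let ?S = "\<lambda>r. qrecip q (int (Suc n) - 2 * r) * qrecip q (int (Suc n) + 2 * r)"
  have nz: "qpoch q q (2 * Suc n) \<noteq> 0" "qpoch q q n \<noteq> 0" "1 - q ^ Suc n \<noteq> 0"
    by (rule qpoch_nonzero one_minus_power_nonzero; use q in simp)+
  have "qpoch (- q) (q\<^sup>2) (Suc n) = (\<Sum>r\<in>{-int N..int N}. alt_wt q r * qbinom_mid q (Suc n) (2 * r))"
    using sum_qbinom_mid_extend[of "Suc n" N "alt_wt q" q] sum_alt_wt_qbinom_mid[OF q, of "Suc n"] \<open>n < N\<close>
    by simp
  also have "\<dots> = qpoch q q (2 * Suc n) * (\<Sum>r\<in>{-int N..int N}. alt_wt q r * ?S r)"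
    unfolding qbinom_mid_def sum_distrib_left by (simp add: mult_ac)
  finally have "reduced_term q n = ?c * (\<Sum>r\<in>{-int N..int N}. alt_wt q r * ?S r)"
    unfolding reduced_term_def using nz(1) by simp
  also have "(\<Sum>r\<in>{-int N..int N}. alt_wt q r * ?S r)
      = ?S 0 + 2 * (\<Sum>r=1..N. alt_wt q (int r) * ?S (int r))"
    by (subst sum_symmetric_int) (simp_all add: alt_wt_def power_int_minus_one_minus mult.commute)
  also have "(\<Sum>r=1..N. alt_wt q (int r) * ?S (int r)) = (\<Sum>r<N. alt_wt q (int (Suc r)) * ?S (int (Suc r)))"
    by (rule sum.reindex_bij_witness[of _ Suc "\<lambda>r. r - 1"]) auto
  also have "?c * (?S 0 + 2 * \<dots>) = ?c * ?S 0 + 2 * (\<Sum>r<N. alt_wt q (int (Suc r)) * (?c * ?S (int (Suc r))))"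
    by (simp add: distrib_left sum_distrib_left mult_ac)
  also have "?c * ?S 0 = q ^ Suc n / (1 - q ^ Suc n)\<^sup>2"
  proof -
    have "qrecip q (int (Suc n)) = 1 / (qpoch q q n * (1 - q ^ Suc n))"
      unfolding qrecip_def by (simp only: nat_int qpoch_Suc) simp
    then show ?thesis using nz(2,3) by (simp add: power2_eq_square)
  qed
  also have "(\<Sum>r<N. alt_wt q (int (Suc r)) * (?c * ?S (int (Suc r))))
     = (\<Sum>r<N. theta_coeff q r *
        (bailey_kernel q (Suc n) (2 * Suc r) - bailey_kernel q n (2 * Suc r)))"
  proof (rule sum.cong[OF refl])
    fix r
    have "?c * ?S (int (Suc r)) = q ^ (2 * Suc r) / (1 - q ^ (2 * Suc r))\<^sup>2 *
        (bailey_kernel q (Suc n) (2 * Suc r) - bailey_kernel q n (2 * Suc r))"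
      using bailey_kernel_telescope[OF q, of "2 * Suc r" n] by simp
    \<comment> \<open>The exponent \<open>2 (r+1)^2\<close> of the weight and \<open>2 (r+1)\<close>
      from the telescoping factor add up to \<open>2 (r+1) (r+2)\<close>.\<close>
    moreover have "alt_wt q (int (Suc r)) * q ^ (2 * Suc r) = (-1) ^ Suc r * q ^ (2 * Suc r * (Suc r + 1))"
    proof -
      have "2 * (int (Suc r))\<^sup>2 = int (2 * (Suc r)\<^sup>2)"
        by simp
      then have "alt_wt q (int (Suc r)) = (-1) ^ Suc r * q ^ (2 * (Suc r)\<^sup>2)"
        unfolding alt_wt_def by (simp only: power_int_of_nat)
      moreover have "2 * (Suc r)\<^sup>2 + 2 * Suc r = 2 * Suc r * (Suc r + 1)"
        by (simp add: power2_eq_square)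
      ultimately show ?thesis by (simp only: mult.assoc flip: power_add)
    qed
    ultimately show "alt_wt q (int (Suc r)) * (?c * ?S (int (Suc r))) = theta_coeff q r *
        (bailey_kernel q (Suc n) (2 * Suc r) - bailey_kernel q n (2 * Suc r))"
      unfolding theta_coeff_def by (metis (no_types, lifting) mult.assoc times_divide_eq_left times_divide_eq_right)
  qed
  finally show ?thesis .
qed

text \<open>After interchanging the sums, the inner one telescopes with lower end 0. The series over
  \<open>r\<close> is in fact finite, since the kernel vanishes for
  \<open>2 * Suc r > N\<close>.\<close>

lemma sum_reduced_term:
  assumes q: "norm q < 1" "q \<noteq> 0"
  shows "(\<Sum>n<N. reduced_term q n) = (\<Sum>n<N. q ^ Suc n / (1 - q ^ Suc n)\<^sup>2)
    + 2 * (\<Sum>r. theta_coeff q r * bailey_kernel q N (2 * Suc r))"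
proof -
  have "(\<Sum>n<N. \<Sum>r<N. theta_coeff q r *
        (bailey_kernel q (Suc n) (2 * Suc r) - bailey_kernel q n (2 * Suc r)))
     = (\<Sum>r<N. theta_coeff q r *
        (\<Sum>n<N. bailey_kernel q (Suc n) (2 * Suc r) - bailey_kernel q n (2 * Suc r)))"
    by (subst sum.swap) (simp add: sum_distrib_left)
  also have "\<dots> = (\<Sum>r<N. theta_coeff q r * bailey_kernel q N (2 * Suc r))"
  proof (rule sum.cong[OF refl], rule arg_cong[where f = "(*) _"])
    fix r
    show "(\<Sum>n<N. bailey_kernel q (Suc n) (2 * Suc r) - bailey_kernel q n (2 * Suc r))
        = bailey_kernel q N (2 * Suc r)"
      using sum_lessThan_telescope[of "\<lambda>n. bailey_kernel q n (2 * Suc r)" N]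
      by (simp add: bailey_kernel_eq_0)
  qed
  also have "\<dots> = (\<Sum>r. theta_coeff q r * bailey_kernel q N (2 * Suc r))"
    by (rule suminf_finite[symmetric]) (auto intro!: bailey_kernel_eq_0)
  finally show ?thesis
    by (simp add: reduced_term_eq[OF q] sum.distrib flip: sum_distrib_left)
qed

subsection \<open>Passage to the limit\<close>

lemma convergent_prod_qpoch:
  assumes "norm q < 1"
  shows "convergent_prod (\<lambda>j. 1 - a * q ^ j :: complex)"
proof (rule abs_convergent_prod_imp_convergent_prod)
  have "summable (\<lambda>j. norm a * norm q ^ j)"
    using assms by (intro summable_mult summable_geometric) simp
  then show "abs_convergent_prod (\<lambda>j. 1 - a * q ^ j)"
    by (simp add: abs_convergent_prod_conv_summable norm_mult norm_power)
qed

lemma qpoch_tendsto: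
  assumes "norm q < 1"
  shows "qpoch a q \<longlonglongrightarrow> qpoch_inf a q"
  using convergent_prod_LIMSEQ[OF convergent_prod_qpoch[OF assms, of a]]
  unfolding qpoch_def qpoch_inf_def by (subst LIMSEQ_lessThan_iff_atMost)

lemma qpoch_inf_nonzero: "norm q < 1 \<Longrightarrow> norm a < 1 \<Longrightarrow> qpoch_inf a q \<noteq> 0"
  unfolding qpoch_inf_def using qpoch_factor_nonzero by (intro prodinf_nonzero convergent_prod_qpoch)

lemma qrecip_int: "qrecip q (int m) = 1 / qpoch q q m"
  by (simp add: qrecip_def)

lemma qrecip_bounded:
  assumes "norm q < 1"
  obtains B where "B > 0" "\<And>j. norm (qrecip q j) \<le> B"
proof -
  have "(\<lambda>n. 1 / qpoch q q n) \<longlonglongrightarrow> 1 / qpoch_inf q q"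
    by (intro tendsto_intros qpoch_tendsto qpoch_inf_nonzero assms)
  then have "Bseq (\<lambda>n. 1 / qpoch q q n)"
    by (rule convergent_imp_Bseq[OF convergentI])
  then obtain B where B: "B > 0" "\<And>n. norm (1 / qpoch q q n) \<le> B"
    by (auto simp: Bseq_def)
  then have "norm (qrecip q j) \<le> B" for j
    by (auto simp: qrecip_def)
  with B(1) show ?thesis by (rule that)
qed

text \<open>The bound is uniform in both \<open>n\<close> and \<open>k\<close>, as the majorant in
  Tannery's theorem requires.\<close>

lemma bailey_kernel_bounded:
  assumes "norm q < 1"
  obtains B where "\<And>n k. norm (bailey_kernel q n k) \<le> B"
proof -
  obtain R where R: "R > 0" "\<And>j. norm (qrecip q j) \<le> R"
    using qrecip_bounded[OF assms] by metis
  have "Bseq (qpoch q q)"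
    by (rule convergent_imp_Bseq[OF convergentI[OF qpoch_tendsto[OF assms]]])
  then obtain A where A: "A > 0" "\<And>n. norm (qpoch q q n) \<le> A"
    by (auto simp: Bseq_def)
  have "norm (bailey_kernel q n k) \<le> A\<^sup>2 * R * R" for n k
    unfolding bailey_kernel_def norm_mult norm_power
    using A R by (intro mult_mono power_mono) auto
  then show ?thesis by (rule that)
qed

text \<open>All four Pochhammer factors tend to the same nonzero limit and cancel. Shifting
  \<open>n\<close> by \<open>k\<close> keeps the indices of both reciprocals nonnegative.\<close>

lemma bailey_kernel_tendsto:
  assumes "norm q < 1"
  shows "(\<lambda>n. bailey_kernel q n k) \<longlonglongrightarrow> 1"
proof -
  let ?L = "qpoch_inf q q"
  note lim = qpoch_tendsto[OF assms, of q] and nz = qpoch_inf_nonzero[OF assms assms]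
  have recip: "(\<lambda>n. 1 / qpoch q q n) \<longlonglongrightarrow> 1 / ?L"
    by (rule tendsto_divide[OF tendsto_const lim nz])
  note recip LIMSEQ_ignore_initial_segment[OF recip, of "k + k"] LIMSEQ_ignore_initial_segment[OF lim, of k]
  then have "(\<lambda>n. (qpoch q q (n + k))\<^sup>2 * (1 / qpoch q q n) * (1 / qpoch q q (n + (k + k))))
      \<longlonglongrightarrow> ?L\<^sup>2 * (1 / ?L) * (1 / ?L)"
    by (intro tendsto_mult tendsto_power)
  also have "(\<lambda>n. (qpoch q q (n + k))\<^sup>2 * (1 / qpoch q q n) * (1 / qpoch q q (n + (k + k))))
      = (\<lambda>n. bailey_kernel q (n + k) k)"
    by (simp add: bailey_kernel_def add.assoc flip: qrecip_int)
  also have "?L\<^sup>2 * (1 / ?L) * (1 / ?L) = 1"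
    using nz by (simp add: power2_eq_square)
  finally show ?thesis by (rule LIMSEQ_offset)
qed

text \<open>The denominator is bounded through \<open>norm (1 - q ^ m) \<ge> 1 - \<rho>\<close>. One
  geometric majorant then serves both series, for Tannery's theorem with
  \<open>\<rho> = norm q\<close> and for uniform convergence on smaller discs.\<close>

lemma norm_power_over_one_minus_power_le:
  fixes q :: "'a :: real_normed_field"
  assumes "norm q \<le> \<rho>" "\<rho> < 1" "r \<le> e" "m > 0"
  shows "norm (q ^ e / (1 - q ^ m)\<^sup>2) \<le> \<rho> ^ r / (1 - \<rho>)\<^sup>2"
proof -
  have \<rho>: "0 \<le> \<rho>" using assms(1) norm_ge_zero order_trans by blast
  have "norm (q ^ m) \<le> \<rho> ^ m"
    unfolding norm_power by (intro power_mono assms) auto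
  also have "\<rho> ^ m \<le> \<rho> ^ 1"
    using \<rho> assms by (intro power_decreasing) auto
  finally have "1 - \<rho> \<le> norm (1 - q ^ m)"
    using norm_triangle_ineq2[of 1 "q ^ m"] by simp
  then have "(1 - \<rho>)\<^sup>2 \<le> (norm (1 - q ^ m))\<^sup>2"
    using assms by (intro power_mono) auto
  moreover have "norm q ^ e \<le> \<rho> ^ r"
  proof -
    have "norm q ^ e \<le> \<rho> ^ e" by (intro power_mono assms) auto
    also have "\<dots> \<le> \<rho> ^ r" using \<rho> assms by (intro power_decreasing) auto
    finally show ?thesis .
  qed
  ultimately show ?thesis
    unfolding norm_divide norm_power using assms \<rho> by (intro frac_le) auto
qed

lemma norm_theta_coeff_le:
  assumes "norm q \<le> \<rho>" "\<rho> < 1"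
  shows "norm (theta_coeff q r) \<le> \<rho> ^ r / (1 - \<rho>)\<^sup>2"
proof -
  have "norm (theta_coeff q r) = norm (q ^ (2 * Suc r * (Suc r + 1)) / (1 - q ^ (2 * Suc r))\<^sup>2)"
    by (simp only: theta_coeff_def norm_divide norm_mult norm_power norm_minus_cancel norm_one power_one mult_1_left)
  also have "\<dots> \<le> \<rho> ^ r / (1 - \<rho>)\<^sup>2"
    by (rule norm_power_over_one_minus_power_le[OF assms]) auto
  finally show ?thesis .
qed

lemma norm_lambert_term_le:
  fixes q :: "'a :: real_normed_field"
  assumes "norm q \<le> \<rho>" "\<rho> < 1"
  shows "norm (q ^ Suc n / (1 - q ^ Suc n)\<^sup>2) \<le> \<rho> ^ n / (1 - \<rho>)\<^sup>2"
  by (rule norm_power_over_one_minus_power_le[OF assms]) auto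

lemma summable_geometric_majorant:
  assumes "0 \<le> \<rho>" "\<rho> < (1 :: real)"
  shows "summable (\<lambda>n. \<rho> ^ n / (1 - \<rho>)\<^sup>2)"
  using assms by (intro summable_divide summable_geometric) auto

lemma reduced_term_sums:
  assumes q: "norm q < 1"
  shows "reduced_term q sums ((\<Sum>n. q ^ Suc n / (1 - q ^ Suc n)\<^sup>2) + 2 * (\<Sum>r. theta_coeff q r))"
\<comment> \<open>The Bailey pair was derived with negative powers of \<open>q\<close>; at
  \<open>q = 0\<close> all summands are 0.\<close>
proof (cases "q = 0")
  case True
  then show ?thesis by (simp add: reduced_term_def theta_coeff_def sums_def)
next
  case False
  obtain B where B: "\<And>n k. norm (bailey_kernel q n k) \<le> B"
    using bailey_kernel_bounded[OF q] by metis
  have maj: "summable (\<lambda>n. norm q ^ n / (1 - norm q)\<^sup>2)"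
    using q by (intro summable_geometric_majorant) auto
  have "(\<lambda>N. \<Sum>r. theta_coeff q r * bailey_kernel q N (2 * Suc r)) \<longlonglongrightarrow> (\<Sum>r. theta_coeff q r)"
  proof (rule tannerys_theorem[THEN conjunct2, THEN conjunct2])
    show "(\<lambda>N. theta_coeff q r * bailey_kernel q N (2 * Suc r)) \<longlonglongrightarrow> theta_coeff q r" for r
      using tendsto_mult[OF tendsto_const bailey_kernel_tendsto[OF q], of "theta_coeff q r" "2 * Suc r"]
      by simp
    show "\<forall>\<^sub>F (r, N) in at_top \<times>\<^sub>F sequentially.
        norm (theta_coeff q r * bailey_kernel q N (2 * Suc r)) \<le> norm q ^ r / (1 - norm q)\<^sup>2 * B"
      unfolding norm_mult case_prod_beta
      by (intro always_eventually allI mult_mono norm_theta_coeff_le B q divide_nonneg_nonneg) auto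
    show "summable (\<lambda>r. norm q ^ r / (1 - norm q)\<^sup>2 * B)"
      by (rule summable_mult2[OF maj])
  qed auto
  moreover have "(\<lambda>N. \<Sum>n<N. q ^ Suc n / (1 - q ^ Suc n)\<^sup>2) \<longlonglongrightarrow> (\<Sum>n. q ^ Suc n / (1 - q ^ Suc n)\<^sup>2)"
    by (intro summable_LIMSEQ summable_comparison_test'[OF maj, of 0] norm_lambert_term_le q) auto
  ultimately show ?thesis
    unfolding sums_def sum_reduced_term[OF q False] by (intro tendsto_intros)
qed

text \<open>Both sides are the double sum of \<open>m q\<^bsup>mn\<^esup>\<close> over \<open>m, n \<ge> 1\<close>.\<close>

lemma lambert_sum_eq:
  fixes q :: complex
  assumes q: "norm q < 1"
  shows "(\<Sum>n. q ^ Suc n / (1 - q ^ Suc n)\<^sup>2) = (\<Sum>n. of_nat (Suc n) * q ^ Suc n / (1 - q ^ Suc n))"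
proof -
  define f where "f = (\<lambda>(n, m). of_nat (Suc m) * q ^ (Suc n * Suc m))"
  have pow: "norm (z ^ Suc n) < 1" if "norm z < 1" for z :: "'a :: real_normed_div_algebra" and n
    using that by (simp add: norm_power power_less_one_iff del: power_Suc)
  \<comment> \<open>The differentiated geometric series at \<open>z ^ Suc n\<close>. The general
    type admits \<open>z = q\<close> for the rows and \<open>z = norm q\<close> for their
    norms.\<close>
  have deriv: "(\<lambda>m. of_nat (Suc m) * z ^ (Suc n * Suc m)) sums (z ^ Suc n / (1 - z ^ Suc n)\<^sup>2)"
    if "norm z < 1" for z :: "'a :: {banach, real_normed_field}" and n
  proof -
    have "z ^ Suc n * (of_nat (Suc m) * (z ^ Suc n) ^ m) = of_nat (Suc m) * z ^ (Suc n * Suc m)" for m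
      unfolding power_mult power_Suc[of "z ^ Suc n"] by (simp only: mult_ac)
    then show ?thesis
      using sums_mult[OF geometric_deriv_sums[OF pow[OF that, of n]], of "z ^ Suc n"]
      by (simp only: times_divide_eq_right mult_1_right)
  qed
  have geo: "(\<lambda>n. f (n, m)) sums (of_nat (Suc m) * q ^ Suc m / (1 - q ^ Suc m))" for m
  proof -
    have "f (n, m) = of_nat (Suc m) * q ^ Suc m * (q ^ Suc m) ^ n" for n
      unfolding f_def prod.case mult.commute[of "Suc n" "Suc m"] power_mult[of q "Suc m" "Suc n"]
        power_Suc[of "q ^ Suc m"]
      by (simp only: mult.assoc)
    then show ?thesis
      using sums_mult[OF geometric_sums[OF pow[OF q, of m]], of "of_nat (Suc m) * q ^ Suc m"]
      by (simp del: power_Suc)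
  qed
  have norm_f: "norm (f (n, m)) = of_nat (Suc m) * norm q ^ (Suc n * Suc m)" for n m
    by (simp only: f_def prod.case norm_mult norm_power norm_of_nat)
  have nderiv: "(\<lambda>m. norm (f (n, m))) sums (norm q ^ Suc n / (1 - norm q ^ Suc n)\<^sup>2)" for n
    unfolding norm_f by (rule deriv) (use q in simp)
  have rows: "((\<lambda>m. f (n, m)) has_sum (q ^ Suc n / (1 - q ^ Suc n)\<^sup>2)) UNIV" for n
    by (rule norm_summable_imp_has_sum[OF sums_summable[OF nderiv]])
      (use deriv[OF q, of n] in \<open>simp only: f_def prod.case\<close>)
  have nrows: "((\<lambda>m. norm (f (n, m))) has_sum (norm q ^ Suc n / (1 - norm q ^ Suc n)\<^sup>2)) UNIV" for n
    by (rule sums_nonneg_imp_has_sum[OF nderiv]) auto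
  have maj: "summable (\<lambda>n. norm q ^ n / (1 - norm q)\<^sup>2)"
    using q by (intro summable_geometric_majorant) auto
  have sm: "(\<lambda>n. norm q ^ Suc n / (1 - norm q ^ Suc n)\<^sup>2) summable_on UNIV"
  proof (rule norm_summable_imp_summable_on, rule summable_comparison_test'[OF maj, of 0])
    fix n
    show "norm (norm (norm q ^ Suc n / (1 - norm q ^ Suc n)\<^sup>2)) \<le> norm q ^ n / (1 - norm q)\<^sup>2"
      using norm_lambert_term_le[of "norm q" "norm q" n] q by (simp only: real_norm_def abs_idempotent abs_norm_cancel order_refl)
  qed
  \<comment> \<open>The norms have summable row sums, so the double family is absolutely summable
    and may be summed by columns.\<close>
  have "(\<lambda>x. norm (f x)) summable_on (UNIV \<times> UNIV)"
    by (rule summable_on_SigmaI[OF _ sm]) (use nrows in auto)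
  then have f: "f summable_on (UNIV \<times> UNIV)"
    by (rule abs_summable_summable)
  have cols: "((\<lambda>n. f (n, m)) has_sum (of_nat (Suc m) * q ^ Suc m / (1 - q ^ Suc m))) UNIV" for m
  proof -
    have "(\<lambda>n. f (n, m)) summable_on UNIV"
      using summable_on_SigmaD1[OF iffD1[OF summable_on_swap f], of m] by (simp add: case_prod_beta)
    then have has_sum: "((\<lambda>n. f (n, m)) has_sum infsum (\<lambda>n. f (n, m)) UNIV) UNIV"
      by (rule has_sum_infsum)
    show ?thesis
      using has_sum sums_unique2[OF has_sum_imp_sums[OF has_sum] geo] by (simp only:)
  qed
  have lam: "((\<lambda>n. q ^ Suc n / (1 - q ^ Suc n)\<^sup>2) has_sum infsum f (UNIV \<times> UNIV)) UNIV"
    by (rule has_sum_SigmaD[OF has_sum_infsum[OF f]]) (rule rows)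
  have cols_sum: "((\<lambda>m. of_nat (Suc m) * q ^ Suc m / (1 - q ^ Suc m)) has_sum infsum f (UNIV \<times> UNIV)) UNIV"
    by (rule has_sum_SigmaD[OF iffD1[OF has_sum_swap has_sum_infsum[OF f]]]) (use cols in auto)
  show ?thesis
    by (rule trans[OF sums_unique[OF has_sum_imp_sums[OF lam], symmetric]
          sums_unique[OF has_sum_imp_sums[OF cols_sum]]])
qed

subsection \<open>The generating function\<close>

lemma qpoch_add: "qpoch a q (m + n) = qpoch a q m * qpoch (a * q ^ m) q n"
  by (induction n) (simp_all add: qpoch_Suc power_add mult_ac)

lemma qpoch_mult_minus: "qpoch a q n * qpoch (- a) q n = qpoch (a\<^sup>2) (q\<^sup>2) n"
  by (induction n) (simp_all add: qpoch_Suc algebra_simps power2_eq_square power_mult_distrib)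

lemma qpoch_even_odd: "qpoch a q (2 * n) = qpoch a (q\<^sup>2) n * qpoch (a * q) (q\<^sup>2) n"
  by (induction n) (simp_all add: qpoch_Suc mult_ac flip: power_mult)

lemma qpoch_inf_split:
  assumes "norm q < 1" "norm a < 1"
  shows "qpoch_inf a q = qpoch a q n * qpoch_inf (a * q ^ n) q"
  using prodinf_split_initial_segment[OF convergent_prod_qpoch[OF assms(1)], of n a]
    qpoch_factor_nonzero[OF assms]
  by (simp add: qpoch_inf_def qpoch_def power_add mult_ac)

abbreviation (input) over_prefactor :: "complex \<Rightarrow> complex" where
  "over_prefactor q \<equiv> qpoch_inf (- (q\<^sup>2)) (q\<^sup>2) / qpoch_inf (q\<^sup>2) (q\<^sup>2)"

text \<open>With \<open>m = Suc n\<close>, the identities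
  \<open>(-q;q)_2m = (-q;q^2)_m (-q^2;q^2)_m\<close> and
  \<open>(q;q)_m (-q;q)_m = (q^2;q^2)_m\<close> supply the factors that complete both infinite
  tails.\<close>

lemma spt_term_eq_reduced_term:
  assumes q: "norm q < 1"
  shows "spt_term q (Suc n) = over_prefactor q * reduced_term q n"
proof -
  define m where "m = Suc n"
  have q2: "norm (q\<^sup>2) < 1" using q by (simp add: norm_power power_less_one_iff)
  let ?A = "qpoch q q m" and ?B = "qpoch (- q) q m"
  let ?E = "qpoch (- (q\<^sup>2)) (q\<^sup>2) m" and ?O = "qpoch (- q) (q\<^sup>2) m"
  let ?I = "qpoch_inf (- (q ^ (2 * m + 2))) (q\<^sup>2)" and ?J = "qpoch_inf (q ^ (2 * m + 2)) (q\<^sup>2)"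
  let ?U = "qpoch (- (q ^ (m + 1))) q m" and ?V = "qpoch (q ^ (m + 1)) q m"
  have nz: "?A \<noteq> 0" "?B \<noteq> 0" "?E \<noteq> 0" "?V \<noteq> 0" "?J \<noteq> 0" "1 - q ^ m \<noteq> 0"
    "qpoch_inf (q\<^sup>2) (q\<^sup>2) \<noteq> 0"
    by (rule qpoch_nonzero qpoch_inf_nonzero one_minus_power_nonzero;
        use q q2 in \<open>simp add: m_def norm_power power_less_one_iff del: power_Suc\<close>)+
  have U: "?B * ?U = ?O * ?E"
    using qpoch_add[of "- q" q m m] qpoch_even_odd[of "- q" q m]
    by (simp add: mult_2 power2_eq_square)
  have V: "?A * ?V = qpoch q q (2 * m)"
    using qpoch_add[of q q m m] by (simp add: mult_2)
  have pw: "q ^ (2 * m + 2) = q\<^sup>2 * (q\<^sup>2) ^ m"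
    unfolding power_add power_mult[of q 2 m] by (rule mult.commute)
  have I: "qpoch_inf (- (q\<^sup>2)) (q\<^sup>2) = ?E * ?I"
    unfolding pw using qpoch_inf_split[OF q2, of "- (q\<^sup>2)" m] q2 by simp
  have J: "qpoch_inf (q\<^sup>2) (q\<^sup>2) = ?A * ?B * ?J"
    unfolding pw qpoch_mult_minus using qpoch_inf_split[OF q2, of "q\<^sup>2" m] q2 by simp
  have A: "?A = qpoch q q n * (1 - q ^ m)"
    by (simp add: m_def qpoch_Suc)
  have U': "?U = ?O * ?E / ?B" using U nz by (simp add: field_simps)
  have "spt_term q m = q ^ m * ?U * ?I / ((1 - q ^ m)\<^sup>2 * ?V * ?J)"
    by (simp add: spt_term_def)
  also have "\<dots> = (?E * ?I) / (?A * ?B * ?J) * (q ^ m * (?A / (1 - q ^ m))\<^sup>2 * ?O / (?A * ?V))"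
  proof -
    have "z * (u * e / b) * i / (d\<^sup>2 * v * j) = (e * i) / (a * b * j) * (z * (a / d)\<^sup>2 * u / (a * v))"
      if "a \<noteq> 0" "b \<noteq> 0" "d \<noteq> 0" "v \<noteq> 0" "j \<noteq> 0" for a b d e i j u v z :: complex
      using that by (simp add: divide_simps power2_eq_square)
    then show ?thesis unfolding U' using nz by blast
  qed
  also have "?A / (1 - q ^ m) = qpoch q q n"
    using A nz by simp
  finally show ?thesis
    unfolding reduced_term_def I[symmetric] J[symmetric] V m_def[symmetric] .
qed

lemma spt_gen_sums:
  assumes q: "norm q < 1"
  shows "(\<lambda>n. spt_term q (Suc n)) sums (over_prefactor q *
     ((\<Sum>n. q ^ Suc n / (1 - q ^ Suc n)\<^sup>2) + 2 * (\<Sum>r. theta_coeff q r)))"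
  unfolding spt_term_eq_reduced_term[OF q] by (rule sums_mult[OF reduced_term_sums[OF q]])

section \<open>Holomorphy in the unit disc\<close>

lemma cball_in_unit_ball:
  fixes x :: complex
  assumes "x \<in> ball 0 1"
  obtains \<rho> d where "0 < d" "0 \<le> \<rho>" "\<rho> < 1" "cball x d \<subseteq> ball 0 1" "\<And>z. z \<in> cball x d \<Longrightarrow> norm z \<le> \<rho>"
proof
  define d where "d = (1 - norm x) / 2"
  show "0 < d" "0 \<le> norm x + d" "norm x + d < 1" using assms by (auto simp: d_def field_simps)
  show *: "norm z \<le> norm x + d" if "z \<in> cball x d" for z
    using that norm_triangle_ineq2[of z x] by (auto simp: dist_norm norm_minus_commute)
  show "cball x d \<subseteq> ball 0 1"
    using * \<open>norm x + d < 1\<close> by fastforce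
qed

text \<open>The Weierstrass M-test on small closed discs gives locally uniform convergence; the
  majorant may depend on the radius \<open>\<rho>\<close>.\<close>

lemma holomorphic_on_suminf_unit_ball:
  fixes f :: "nat \<Rightarrow> complex \<Rightarrow> complex"
  assumes hol: "\<And>n. f n holomorphic_on ball 0 1"
    and bound: "\<And>\<rho> n z. 0 \<le> \<rho> \<Longrightarrow> \<rho> < 1 \<Longrightarrow> norm z \<le> \<rho> \<Longrightarrow> norm (f n z) \<le> M \<rho> n"
    and summable: "\<And>\<rho>. 0 \<le> \<rho> \<Longrightarrow> \<rho> < 1 \<Longrightarrow> summable (M \<rho>)"
  shows "(\<lambda>z. \<Sum>n. f n z) holomorphic_on ball 0 1"
proof (rule holomorphic_uniform_sequence)
  show "(\<lambda>z. \<Sum>i<n. f i z) holomorphic_on ball 0 1" for n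
    by (intro holomorphic_intros hol)
  fix x :: complex assume "x \<in> ball 0 1"
  then obtain \<rho> d where *: "0 < d" "0 \<le> \<rho>" "\<rho> < 1" "cball x d \<subseteq> ball 0 1"
      "\<And>z. z \<in> cball x d \<Longrightarrow> norm z \<le> \<rho>"
    by (rule cball_in_unit_ball) blast
  then have "uniform_limit (cball x d) (\<lambda>n z. \<Sum>i<n. f i z) (\<lambda>z. \<Sum>n. f n z) sequentially"
    by (intro Weierstrass_m_test[of _ _ "M \<rho>"] bound summable) auto
  with * show "\<exists>d>0. cball x d \<subseteq> ball 0 1 \<and>
      uniform_limit (cball x d) (\<lambda>n z. \<Sum>i<n. f i z) (\<lambda>z. \<Sum>n. f n z) sequentially"
    by blast
qed auto

text \<open>The parameter \<open>c\<close> covers both products of the prefactor, with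
  \<open>c = 1\<close> and \<open>c = -1\<close>.\<close>

lemma holomorphic_qpoch_inf:
  assumes c: "norm c \<le> 1"
  shows "(\<lambda>z. qpoch_inf (c * z\<^sup>2) (z\<^sup>2)) holomorphic_on ball 0 1"
proof (rule holomorphic_uniform_sequence)
  show "(\<lambda>z. qpoch (c * z\<^sup>2) (z\<^sup>2) n) holomorphic_on ball 0 1" for n
    unfolding qpoch_def by (intro holomorphic_intros)
  fix x :: complex assume "x \<in> ball 0 1"
  then obtain \<rho> d where *: "0 < d" "0 \<le> \<rho>" "\<rho> < 1" "cball x d \<subseteq> ball 0 1"
      "\<And>z. z \<in> cball x d \<Longrightarrow> norm z \<le> \<rho>"
    by (rule cball_in_unit_ball) blast
  have "uniformly_convergent_on (cball x d) (\<lambda>n z. qpoch (c * z\<^sup>2) (z\<^sup>2) n)"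
    unfolding qpoch_def
  proof (rule uniformly_convergent_on_prod')
    have "norm (norm (1 - c * z\<^sup>2 * (z\<^sup>2) ^ n - 1)) \<le> \<rho> ^ n" if "z \<in> cball x d" for n z
    proof -
      have "norm (norm (1 - c * z\<^sup>2 * (z\<^sup>2) ^ n - 1)) = norm c * norm z ^ (2 + 2 * n)"
        by (simp add: norm_mult norm_power power_mult power2_eq_square power_mult_distrib mult_ac)
      also have "\<dots> \<le> 1 * \<rho> ^ (2 + 2 * n)"
        using c *(5)[OF that] by (intro mult_mono power_mono) auto
      also have "\<dots> \<le> \<rho> ^ n"
        unfolding mult_1 using * by (intro power_decreasing) auto
      finally show ?thesis .
    qed
    then show "uniformly_convergent_on (cball x d) (\<lambda>N z. \<Sum>n<N. norm (1 - c * z\<^sup>2 * (z\<^sup>2) ^ n - 1))"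
      by (rule Weierstrass_m_test') (use * in \<open>auto intro: summable_geometric\<close>)
  qed (auto intro!: continuous_intros)
  then obtain g where g: "uniform_limit (cball x d) (\<lambda>n z. qpoch (c * z\<^sup>2) (z\<^sup>2) n) g sequentially"
    by (auto simp: uniformly_convergent_on_def)
  \<comment> \<open>Uniform convergence provides only some limit \<open>g\<close>; pointwise
    convergence identifies it.\<close>
  have eq: "g z = qpoch_inf (c * z\<^sup>2) (z\<^sup>2)" if "z \<in> cball x d" for z
  proof (rule LIMSEQ_unique[OF tendsto_uniform_limitI[OF g that]])
    have "norm (z\<^sup>2) < 1"
      using *(3) *(5)[OF that] by (simp add: norm_power power_less_one_iff)
    then show "qpoch (c * z\<^sup>2) (z\<^sup>2) \<longlonglongrightarrow> qpoch_inf (c * z\<^sup>2) (z\<^sup>2)"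
      by (rule qpoch_tendsto)
  qed
  have "uniform_limit (cball x d) (\<lambda>n z. qpoch (c * z\<^sup>2) (z\<^sup>2) n) g sequentially \<longleftrightarrow>
      uniform_limit (cball x d) (\<lambda>n z. qpoch (c * z\<^sup>2) (z\<^sup>2) n)
        (\<lambda>z. qpoch_inf (c * z\<^sup>2) (z\<^sup>2)) sequentially"
    by (rule uniform_limit_cong') (use eq in auto)
  with * g show "\<exists>d>0. cball x d \<subseteq> ball 0 1 \<and> uniform_limit (cball x d)
      (\<lambda>n z. qpoch (c * z\<^sup>2) (z\<^sup>2) n) (\<lambda>z. qpoch_inf (c * z\<^sup>2) (z\<^sup>2)) sequentially"
    by blast
qed auto

text \<open>Holomorphy is read off from the closed form, whose two series have geometric majorants
  and whose denominators have no zero in the disc.\<close>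

lemma holomorphic_spt_gen: "spt_gen holomorphic_on ball 0 1"
proof -
  have nz: "1 - z ^ n \<noteq> 0" if "z \<in> ball 0 1" "n > 0" for z :: complex and n
    using one_minus_power_nonzero[of z n] that by simp
  have "(\<lambda>z::complex. \<Sum>n. z ^ Suc n / (1 - z ^ Suc n)\<^sup>2) holomorphic_on ball 0 1"
  proof (rule holomorphic_on_suminf_unit_ball[where M = "\<lambda>\<rho> n. \<rho> ^ n / (1 - \<rho>)\<^sup>2"])
    show "(\<lambda>z::complex. z ^ Suc n / (1 - z ^ Suc n)\<^sup>2) holomorphic_on ball 0 1" for n
      by (intro holomorphic_intros) (use nz[of _ "Suc n"] in auto)
  qed (rule norm_lambert_term_le summable_geometric_majorant; assumption)+
  moreover have "(\<lambda>z. \<Sum>n. theta_coeff z n) holomorphic_on ball 0 1"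
  proof (rule holomorphic_on_suminf_unit_ball[where M = "\<lambda>\<rho> n. \<rho> ^ n / (1 - \<rho>)\<^sup>2"])
    show "(\<lambda>z. theta_coeff z n) holomorphic_on ball 0 1" for n
      unfolding theta_coeff_def by (intro holomorphic_intros) (use nz[of _ "2 * Suc n"] in auto)
  qed (rule norm_theta_coeff_le summable_geometric_majorant; assumption)+
  moreover have "(\<lambda>z. over_prefactor z) holomorphic_on ball 0 1"
  proof (intro holomorphic_on_divide)
    show "qpoch_inf (z\<^sup>2) (z\<^sup>2) \<noteq> 0" if "z \<in> ball 0 1" for z
      using that by (intro qpoch_inf_nonzero) (auto simp: norm_power power_less_one_iff)
  qed (use holomorphic_qpoch_inf[of 1] holomorphic_qpoch_inf[of "-1"] in simp_all)
  ultimately have "(\<lambda>z. over_prefactor z *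
      ((\<Sum>n. z ^ Suc n / (1 - z ^ Suc n)\<^sup>2) + 2 * (\<Sum>n. theta_coeff z n))) holomorphic_on ball 0 1"
    by (intro holomorphic_on_mult holomorphic_on_add holomorphic_on_const)
  then show ?thesis
  proof (rule holomorphic_transform)
    fix z :: complex assume "z \<in> ball 0 1"
    then show "over_prefactor z *
      ((\<Sum>n. z ^ Suc n / (1 - z ^ Suc n)\<^sup>2) + 2 * (\<Sum>n. theta_coeff z n)) = spt_gen z"
      unfolding spt_gen_def by (intro sums_unique[OF spt_gen_sums]) simp
  qed
qed

theorem theorem5p1:
  fixes q :: complex
  assumes "norm q < 1"
  shows "(\<lambda>n. spt_bar_omega (Suc n) * q ^ (Suc n)) sums
    (qpoch_inf (- (q ^ 2)) (q ^ 2) / qpoch_inf (q ^ 2) (q ^ 2)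
       * (\<Sum>n. of_nat (Suc n) * q ^ (Suc n) / (1 - q ^ (Suc n)))
     + 2 * (qpoch_inf (- (q ^ 2)) (q ^ 2) / qpoch_inf (q ^ 2) (q ^ 2))
       * (\<Sum>n. (-1) ^ (Suc n) * q ^ (2 * Suc n * (Suc n + 1))
                 / (1 - q ^ (2 * Suc n)) ^ 2))"
proof -
  \<comment> \<open>The \<open>spt_bar_omega n\<close> are Taylor coefficients at 0, and the Taylor
    series converges throughout the disc of holomorphy.\<close>
  have "(\<lambda>n. spt_bar_omega n * q ^ n) sums spt_gen q"
    unfolding spt_bar_omega_def
    using holomorphic_power_series[OF holomorphic_spt_gen, of q] assms by simp
  \<comment> \<open>Every summand of \<open>spt_gen 0\<close> has a factor \<open>0 ^ Suc n\<close>,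
    so the series may start at index 1.\<close>
  moreover have "spt_bar_omega 0 = 0"
    by (simp add: spt_bar_omega_def spt_gen_def spt_term_def)
  ultimately have "(\<lambda>n. spt_bar_omega (Suc n) * q ^ Suc n) sums spt_gen q"
    by (subst sums_Suc_iff) simp
  also have "spt_gen q = over_prefactor q *
      ((\<Sum>n. of_nat (Suc n) * q ^ Suc n / (1 - q ^ Suc n)) + 2 * (\<Sum>n. theta_coeff q n))"
    unfolding spt_gen_def lambert_sum_eq[OF assms, symmetric]
    by (rule sums_unique[OF spt_gen_sums[OF assms], symmetric])
  finally show ?thesis
    unfolding theta_coeff_def by (simp only: distrib_left mult_ac)
qed

end
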